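(* The function $D$ has exactly one zero, counted with multiplicity, in the disc $|q|<1/2$. It is a positive simple zero $q_0$, and $$\frac{29}{100}<q_0<\frac{293}{1000}.$$
   Context: For complex $|q|<1$, $D(q):=\sum_{k\ge0}(-1)^{T_k}(2k+1)q^{T_k}$, where $T_k=k(k+1)/2$. *)

theory Defs
  imports "HOL-Complex_Analysis.Complex_Analysis"
begin

definition T :: "nat \<Rightarrow> nat" where
  "T k = k * (k + 1) div 2"

text \<open>Meaningful for \<open>norm q < 1\<close>, where the series converges.\<close>

definition D :: "complex \<Rightarrow> complex" where
  "D q = (\<Sum>k. (-1) ^ T k * of_nat (2 * k + 1) * q ^ T k)"

end

theory Submission
  imports Defs
begin

text \<open>
  The series begins \<open>D q = 1 - 3 q - 5 q^3 + 7 q^6 + 9 q^10 - \<dots>\<close>, and the exponents grow so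
  fast that on the disc of radius \<open>1/2\<close> everything beyond \<open>q^10\<close> is bounded by \<open>12 |q|^15\<close>
  (lemma \<open>norm_D_tail_le\<close>).

  Existence is the intermediate value theorem on \<open>[29/100, 293/1000]\<close>: \<open>D\<close> is real on the real
  axis, and the five displayed terms dominate the tail at both endpoints.

  Uniqueness and simplicity both come from one comparison of difference quotients
  (lemma \<open>D_eq_imp_eq\<close>), in place of Rouche's theorem. If \<open>D z = D w\<close> with \<open>z \<noteq> w\<close>, dividing the
  difference by \<open>z - w\<close> shows that the linear term \<open>-3\<close> is balanced by the divided differences of
  the higher powers. These are at most \<open>(r^n - s^n) / (r - s)\<close> when \<open>|z| \<le> r\<close>
  and \<open>|w| \<le> s < r\<close>. For \<open>r = 1/2\<close> and \<open>s = 293/1000\<close> the weighted sum of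
  these bounds is about \<open>2.963 < 3\<close>, a contradiction. Taking for \<open>w\<close> the zero on the real axis,
  no other zero \<open>z\<close> exists in the disc of radius \<open>1/2\<close>. Taking both
  points in the disc of radius \<open>293/1000\<close>, \<open>D\<close> is injective there, so \<open>D'\<close> does not vanish at the
  zero. The asymmetry matters: for two points of modulus near \<open>1/2\<close> the cubic term
  alone would contribute up to \<open>15/4 > 3\<close>.
\<close>

section \<open>The tail of the series\<close>

definition D_tail :: "complex \<Rightarrow> complex" where
  "D_tail q = (\<Sum>k. (-1) ^ T (k + 5) * of_nat (2 * (k + 5) + 1) * q ^ T (k + 5))"

lemma T_ge: "15 + 6 * k \<le> T (k + 5)"
proof -
  have "k \<le> k * k" by (cases k) auto
  hence "2 * (15 + 6 * k) \<le> (k + 5) * (k + 5 + 1)"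
    by (simp add: algebra_simps)
  from div_le_mono[OF this, of 2] show ?thesis by (simp add: T_def)
qed

lemma Suc_double_le_power2: "real (2 * (k + 5) + 1) \<le> 11 * 2 ^ k"
  by (induction k) auto

text \<open>
  Since \<open>T (k + 5) \<ge> 15 + 6 k\<close> and \<open>2 k + 11 \<le> 11 * 2^k\<close>, the ratio of the dominating series is
  \<open>2 x^6\<close>, at most \<open>1/32\<close>.
\<close>

lemma tail_term_le:
  fixes x :: real
  assumes "0 \<le> x" "x \<le> 1/2"
  shows "real (2 * (k + 5) + 1) * x ^ T (k + 5) \<le> 11 * x ^ 15 * (1/32) ^ k"
proof -
  have "x ^ T (k + 5) \<le> x ^ (15 + 6 * k)"
    using assms T_ge by (intro power_decreasing) auto
  also have "\<dots> = x ^ 15 * (x ^ 6) ^ k"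
    by (simp add: power_add power_mult)
  also have "\<dots> \<le> x ^ 15 * ((1/2) ^ 6) ^ k"
    using assms by (intro mult_left_mono power_mono) auto
  finally have "real (2 * (k + 5) + 1) * x ^ T (k + 5) \<le> (11 * 2 ^ k) * (x ^ 15 * ((1/2) ^ 6) ^ k)"
    using assms Suc_double_le_power2 by (intro mult_mono) auto
  also have "\<dots> = 11 * x ^ 15 * (2 ^ k * ((1/2) ^ 6) ^ k)" by (simp only: mult_ac)
  also have "(2::real) ^ k * ((1/2) ^ 6) ^ k = (1/32) ^ k"
    by (simp only: flip: power_mult_distrib) (simp add: power_divide)
  finally show ?thesis .
qed

lemma majorant_sums: "(\<lambda>k. 11 * c * (1/32) ^ k) sums (352/31 * c)" for c :: real
  using sums_mult[OF geometric_sums[of "1/32::real"], of "11 * c"] by simp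

lemma norm_D_term_le:
  fixes q :: complex
  assumes "norm q \<le> 1/2"
  shows "norm ((-1) ^ T (k + 5) * of_nat (2 * (k + 5) + 1) * q ^ T (k + 5))
           \<le> 11 * norm q ^ 15 * (1/32) ^ k"
proof -
  have "norm ((-1) ^ T (k + 5) * of_nat (2 * (k + 5) + 1) * q ^ T (k + 5))
          = real (2 * (k + 5) + 1) * norm q ^ T (k + 5)"
    by (simp only: norm_mult norm_power norm_of_nat norm_minus_cancel norm_one power_one mult_1)
  thus ?thesis using tail_term_le[OF norm_ge_zero assms, of k] by (simp only:)
qed

lemma summable_D_tail:
  fixes q :: complex
  assumes "norm q \<le> 1/2"
  shows "summable (\<lambda>k. (-1) ^ T (k + 5) * of_nat (2 * (k + 5) + 1) * q ^ T (k + 5))"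
  by (rule summable_comparison_test'[OF sums_summable[OF majorant_sums[of "norm q ^ 15"]]])
    (rule norm_D_term_le[OF assms])

lemma summable_D:
  fixes q :: complex
  assumes "norm q \<le> 1/2"
  shows "summable (\<lambda>k. (-1) ^ T k * of_nat (2 * k + 1) * q ^ T k)"
  using summable_D_tail[OF assms]
    summable_iff_shift[of "\<lambda>k. (-1) ^ T k * of_nat (2 * k + 1) * q ^ T k" 5] by blast

lemma norm_D_tail_le:
  assumes "norm q \<le> 1/2"
  shows "norm (D_tail q) \<le> 12 * norm q ^ 15"
proof -
  note s = majorant_sums[of "norm q ^ 15"]
  have "norm (D_tail q) \<le> (\<Sum>k. 11 * norm q ^ 15 * (1/32) ^ k)"
    unfolding D_tail_def using norm_D_term_le[OF assms] sums_summable[OF s]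
    by (rule norm_suminf_le)
  also have "\<dots> = 352/31 * norm q ^ 15" using s by (rule sums_unique[symmetric])
  also have "\<dots> \<le> 12 * norm q ^ 15" by (intro mult_right_mono) auto
  finally show ?thesis .
qed

lemma D_eq:
  assumes "norm q \<le> 1/2"
  shows "D q = 1 - 3 * q - 5 * q ^ 3 + 7 * q ^ 6 + 9 * q ^ 10 + D_tail q"
proof -
  have "D q = D_tail q + (\<Sum>k<5. (-1) ^ T k * of_nat (2 * k + 1) * q ^ T k)"
    unfolding D_def D_tail_def by (rule suminf_split_initial_segment[OF summable_D[OF assms]])
  moreover have "{..<5::nat} = {0, 1, 2, 3, 4}" by auto
  ultimately show ?thesis by (simp add: T_def)
qed

lemma holomorphic_D: "D holomorphic_on ball 0 (1/2)"
proof -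
  let ?f = "\<lambda>k (q::complex). (-1) ^ T (k + 5) * of_nat (2 * (k + 5) + 1) * q ^ T (k + 5)"
  have bd: "norm (?f k q) \<le> 11 * (1/2) ^ 15 * (1/32) ^ k" if "q \<in> ball 0 (1/2)" for k q
  proof -
    have q: "norm q \<le> 1/2" using that by simp
    have "11 * norm q ^ 15 * (1/32) ^ k \<le> 11 * (1/2) ^ 15 * (1/32) ^ k"
      using q by (intro mult_right_mono mult_left_mono power_mono) auto
    with norm_D_term_le[OF q, of k] show ?thesis by linarith
  qed
  have der: "(?f k has_field_derivative
      (-1) ^ T (k + 5) * of_nat (2 * (k + 5) + 1) * (of_nat (T (k + 5)) * q ^ (T (k + 5) - 1))) (at q)"
    for k q
    by (rule derivative_eq_intros refl | simp)+
  have ev: "\<forall>\<^sub>F k in sequentially. \<forall>q\<in>ball 0 (1/2). norm (?f k q) \<le> 11 * (1/2) ^ 15 * (1/32) ^ k"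
    using bd by (intro always_eventually allI ballI)
  obtain g g' where g: "\<forall>q\<in>ball 0 (1/2). (\<lambda>k. ?f k q) sums g q \<and>
      (\<lambda>k. (-1) ^ T (k + 5) * of_nat (2 * (k + 5) + 1) * (of_nat (T (k + 5)) * q ^ (T (k + 5) - 1)))
        sums g' q \<and> (g has_field_derivative g' q) (at q)"
    by (rule series_and_derivative_comparison[OF open_ball
        sums_summable[OF majorant_sums[of "(1/2) ^ 15"]] der ev])
  have "g holomorphic_on ball 0 (1/2)"
    using g by (auto simp: holomorphic_on_open)
  hence "D_tail holomorphic_on ball 0 (1/2)"
    by (rule holomorphic_transform)
      (use g in \<open>auto simp: D_tail_def intro!: sums_unique\<close>)
  hence "(\<lambda>q. 1 - 3 * q - 5 * q ^ 3 + 7 * q ^ 6 + 9 * q ^ 10 + D_tail q) holomorphic_on ball 0 (1/2)"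
    by (intro holomorphic_intros)
  thus ?thesis by (rule holomorphic_transform) (simp add: D_eq)
qed

section \<open>Uniqueness through difference quotients\<close>

text \<open>
  The divided difference \<open>\<Sum> w^(n-1-i) z^i\<close> of the \<open>n\<close>-th power is dominated termwise by that of
  \<open>r\<close> and \<open>s\<close>. Multiplying by \<open>r - s\<close> keeps the bound free of division.
\<close>

lemma norm_power_diff_le_real_power_diff:
  fixes z w :: "'a :: {real_normed_field}"
  assumes "norm z \<le> r" "norm w \<le> s" "s \<le> r"
  shows "(r - s) * norm (z ^ n - w ^ n) \<le> (r ^ n - s ^ n) * norm (z - w)"
proof -
  have nonneg: "0 \<le> r" "0 \<le> s" using assms norm_ge_zero order_trans by blast+
  have "norm (\<Sum>i<n. w ^ (n - Suc i) * z ^ i) \<le> (\<Sum>i<n. s ^ (n - Suc i) * r ^ i)"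
    using assms nonneg
    by (intro sum_norm_le) (auto simp: norm_mult norm_power intro!: mult_mono power_mono)
  hence "(r - s) * (norm (z - w) * norm (\<Sum>i<n. w ^ (n - Suc i) * z ^ i))
           \<le> (r - s) * (norm (z - w) * (\<Sum>i<n. s ^ (n - Suc i) * r ^ i))"
    using assms by (intro mult_left_mono) auto
  thus ?thesis
    by (simp add: power_diff_sumr2 norm_mult mult_ac)
qed

lemma D_tail_diff_le:
  assumes "norm z \<le> r" "norm w \<le> s" "s \<le> r" "r \<le> 1/2"
  shows "(r - s) * norm (D_tail z - D_tail w) \<le> 12 * r ^ 15 * norm (z - w)"
proof -
  have r: "0 \<le> r" and s: "0 \<le> s" using assms norm_ge_zero order_trans by blast+
  let ?c = "\<lambda>k. (-1) ^ T (k + 5) * of_nat (2 * (k + 5) + 1) :: complex"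
  have sz: "summable (\<lambda>k. ?c k * z ^ T (k + 5))" and sw: "summable (\<lambda>k. ?c k * w ^ T (k + 5))"
    using assms by (intro summable_D_tail; linarith)+
  have "norm (of_real (r - s) * (?c k * z ^ T (k + 5) - ?c k * w ^ T (k + 5)))
          \<le> 11 * (r ^ 15 * norm (z - w)) * (1/32) ^ k" for k
  proof -
    have "norm (of_real (r - s) * (?c k * z ^ T (k + 5) - ?c k * w ^ T (k + 5)))
            = real (2 * (k + 5) + 1) * ((r - s) * norm (z ^ T (k + 5) - w ^ T (k + 5)))"
      using assms(3)
      by (simp only: flip: right_diff_distrib)
        (simp only: norm_mult norm_power norm_of_nat norm_minus_cancel norm_one power_one mult_1
          norm_of_real abs_of_nonneg diff_ge_0_iff_ge mult.left_commute)
    also have "\<dots> \<le> real (2 * (k + 5) + 1) * ((r ^ T (k + 5) - s ^ T (k + 5)) * norm (z - w))"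
      using assms by (intro mult_left_mono norm_power_diff_le_real_power_diff) auto
    also have "\<dots> \<le> real (2 * (k + 5) + 1) * (r ^ T (k + 5) * norm (z - w))"
      using s by (intro mult_left_mono mult_right_mono) auto
    also have "\<dots> \<le> 11 * r ^ 15 * (1/32) ^ k * norm (z - w)"
      unfolding mult.assoc[symmetric]
      using tail_term_le[of r k] r assms by (intro mult_right_mono) auto
    finally show ?thesis by (simp only: mult_ac)
  qed
  hence "norm (\<Sum>k. of_real (r - s) * (?c k * z ^ T (k + 5) - ?c k * w ^ T (k + 5)))
          \<le> (\<Sum>k. 11 * (r ^ 15 * norm (z - w)) * (1/32) ^ k)"
    by (rule norm_suminf_le) (rule sums_summable[OF majorant_sums])
  also have "(\<Sum>k. of_real (r - s) * (?c k * z ^ T (k + 5) - ?c k * w ^ T (k + 5)))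
          = of_real (r - s) * (D_tail z - D_tail w)"
    unfolding D_tail_def
    by (simp only: suminf_mult[OF summable_diff[OF sz sw]] suminf_diff[OF sz sw])
  also have "norm (of_real (r - s) * (D_tail z - D_tail w)) = (r - s) * norm (D_tail z - D_tail w)"
    using assms(3) by (simp only: norm_mult norm_of_real abs_of_nonneg diff_ge_0_iff_ge)
  also have "(\<Sum>k. 11 * (r ^ 15 * norm (z - w)) * (1/32) ^ k) = 352/31 * (r ^ 15 * norm (z - w))"
    by (rule sums_unique[OF majorant_sums, symmetric])
  also have "\<dots> \<le> 12 * (r ^ 15 * norm (z - w))"
    using r by (intro mult_right_mono) auto
  finally show ?thesis by (simp only: mult.assoc)
qed

text \<open>
  The numerical core: with \<open>r - s = 207/1000\<close>, the bound on the divided differences amounts to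
  \<open>5 (r^3 - s^3) + 7 (r^6 - s^6) + 9 (r^10 - s^10) + 12 r^15 < 3 (r - s)\<close>.
\<close>

lemma D_eq_imp_eq:
  assumes "norm z \<le> 1/2" "norm w \<le> 293/1000" "D z = D w"
  shows "z = w"
proof (rule ccontr)
  assume "z \<noteq> w"
  define r s :: real where "r = 1/2" and "s = 293/1000"
  define N where "N = norm (z - w)"
  have N: "N > 0" using \<open>z \<noteq> w\<close> by (simp add: N_def)
  have zw: "norm z \<le> r" "norm w \<le> s" "s \<le> r" "r \<le> 1/2" using assms by (auto simp: r_def s_def)
  note pow = norm_power_diff_le_real_power_diff[OF zw(1-3), folded N_def]
  have "3 * (z - w) = - (5 * (z ^ 3 - w ^ 3)) + 7 * (z ^ 6 - w ^ 6) + 9 * (z ^ 10 - w ^ 10)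
          + (D_tail z - D_tail w)"
    using assms D_eq[of z] D_eq[of w] by (simp add: algebra_simps)
  hence "norm (3 * (z - w)) = norm (- (5 * (z ^ 3 - w ^ 3)) + 7 * (z ^ 6 - w ^ 6)
          + 9 * (z ^ 10 - w ^ 10) + (D_tail z - D_tail w))" by simp
  also have "\<dots> \<le> norm (- (5 * (z ^ 3 - w ^ 3))) + norm (7 * (z ^ 6 - w ^ 6))
      + norm (9 * (z ^ 10 - w ^ 10)) + norm (D_tail z - D_tail w)"
    by (intro norm_triangle_mono) auto
  finally have "3 * N \<le> 5 * norm (z ^ 3 - w ^ 3) + 7 * norm (z ^ 6 - w ^ 6)
      + 9 * norm (z ^ 10 - w ^ 10) + norm (D_tail z - D_tail w)"
    by (simp only: norm_minus_cancel norm_mult norm_numeral N_def)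
  hence "(r - s) * (3 * N) \<le> (r - s) * (5 * norm (z ^ 3 - w ^ 3) + 7 * norm (z ^ 6 - w ^ 6)
      + 9 * norm (z ^ 10 - w ^ 10) + norm (D_tail z - D_tail w))"
    using zw by (intro mult_left_mono) auto
  also have "\<dots> = 5 * ((r - s) * norm (z ^ 3 - w ^ 3)) + 7 * ((r - s) * norm (z ^ 6 - w ^ 6))
      + 9 * ((r - s) * norm (z ^ 10 - w ^ 10)) + (r - s) * norm (D_tail z - D_tail w)"
    by (simp only: distrib_left mult.left_commute)
  also have "\<dots> \<le> 5 * ((r ^ 3 - s ^ 3) * N) + 7 * ((r ^ 6 - s ^ 6) * N)
      + 9 * ((r ^ 10 - s ^ 10) * N) + 12 * r ^ 15 * N"
    using D_tail_diff_le[OF zw, folded N_def] pow by (intro add_mono mult_left_mono) auto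
  finally have "(3 * (r - s)) * N
      \<le> (5 * (r ^ 3 - s ^ 3) + 7 * (r ^ 6 - s ^ 6) + 9 * (r ^ 10 - s ^ 10) + 12 * r ^ 15) * N"
    by (simp only: distrib_right mult.assoc)
  hence "3 * (r - s)
      \<le> 5 * (r ^ 3 - s ^ 3) + 7 * (r ^ 6 - s ^ 6) + 9 * (r ^ 10 - s ^ 10) + 12 * r ^ 15"
    using N by (simp only: mult_le_cancel_right_pos)
  thus False by (simp add: r_def s_def power_divide)
qed

section \<open>The real zero\<close>

lemma D_of_real:
  assumes "\<bar>x\<bar> \<le> 1/2"
  shows "D (of_real x) = of_real (Re (D (of_real x)))"
proof -
  let ?f = "\<lambda>k. (-1) ^ T k * of_nat (2 * k + 1) * complex_of_real x ^ T k"
  have f: "?f k = of_real ((-1) ^ T k * of_nat (2 * k + 1) * x ^ T k)" for k by simp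
  have "summable ?f" using assms by (intro summable_D) simp
  hence "?f sums D (of_real x)" unfolding D_def by (rule summable_sums)
  hence "(\<lambda>k. Im (?f k)) sums Im (D (of_real x))" by (rule sums_Im)
  hence "(\<lambda>k. 0) sums Im (D (of_real x))" by (simp only: f Im_complex_of_real)
  from sums_unique2[OF this sums_zero] have "Im (D (of_real x)) = 0" .
  thus ?thesis by (simp add: complex_eq_iff)
qed

lemma Re_D_approx:
  assumes "0 \<le> x" "x \<le> 1/2"
  shows "\<bar>Re (D (of_real x)) - (1 - 3 * x - 5 * x ^ 3 + 7 * x ^ 6 + 9 * x ^ 10)\<bar> \<le> 12 * x ^ 15"
proof -
  have x: "norm (complex_of_real x) \<le> 1/2" using assms by simp
  have "Re (D (of_real x))
      = Re (of_real (1 - 3 * x - 5 * x ^ 3 + 7 * x ^ 6 + 9 * x ^ 10) + D_tail (of_real x))"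
    unfolding D_eq[OF x] by simp
  hence "Re (D (of_real x)) - (1 - 3 * x - 5 * x ^ 3 + 7 * x ^ 6 + 9 * x ^ 10) = Re (D_tail (of_real x))"
    unfolding plus_complex.sel Re_complex_of_real by linarith
  moreover have "\<bar>Re (D_tail (of_real x))\<bar> \<le> 12 * x ^ 15"
    using norm_D_tail_le[OF x] abs_Re_le_cmod[of "D_tail (of_real x)"] assms by simp
  ultimately show ?thesis by simp
qed

lemma ex_real_zero: "\<exists>x::real. 29/100 < x \<and> x < 293/1000 \<and> D (of_real x) = 0"
proof -
  let ?d = "\<lambda>x. Re (D (complex_of_real x))"
  have pos: "?d (29/100) > 0"
  proof -
    have "0 < 1 - 3 * (29/100) - 5 * (29/100) ^ 3 + 7 * (29/100) ^ 6 + 9 * (29/100) ^ 10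
            - 12 * (29/100 :: real) ^ 15"
      by (simp add: power_divide)
    with Re_D_approx[of "29/100"] show ?thesis by linarith
  qed
  have neg: "?d (293/1000) < 0"
  proof -
    have "1 - 3 * (293/1000) - 5 * (293/1000) ^ 3 + 7 * (293/1000) ^ 6 + 9 * (293/1000) ^ 10
            + 12 * (293/1000 :: real) ^ 15 < 0"
      by (simp add: power_divide)
    with Re_D_approx[of "293/1000"] show ?thesis by linarith
  qed
  have "continuous_on {29/100..293/1000} (\<lambda>x. D (complex_of_real x))"
    by (rule continuous_on_compose2[OF holomorphic_on_imp_continuous_on[OF holomorphic_D]])
      (auto intro!: continuous_intros)
  hence "continuous_on {29/100..293/1000} ?d" by (intro continuous_intros)
  then obtain x where x: "29/100 \<le> x" "x \<le> 293/1000" "?d x = 0"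
    using IVT2'[of ?d "293/1000" 0 "29/100"] pos neg by auto
  moreover have "x \<noteq> 29/100" "x \<noteq> 293/1000" using x pos neg by (metis less_irrefl)+
  ultimately show ?thesis using D_of_real[of x] by (intro exI[of _ x]) auto
qed

text \<open>
  By lemma \<open>D_eq_imp_eq\<close>, \<open>D\<close> is injective near the zero, so its derivative there is nonzero.
\<close>

lemma zorder_D_eq_1:
  assumes "norm q < 293/1000" "D q = 0"
  shows "zorder D q = 1"
proof -
  have sub: "ball 0 (293/1000) \<subseteq> ball (0::complex) (1/2)" by auto
  have hol: "D holomorphic_on ball 0 (293/1000)"
    using holomorphic_D sub by (rule holomorphic_on_subset)
  moreover have "inj_on D (ball 0 (293/1000))"
    by (rule inj_onI, rule D_eq_imp_eq) auto
  ultimately have "deriv D q \<noteq> 0"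
    using assms by (intro holomorphic_injective_imp_regular[of D "ball 0 (293/1000)"]) auto
  thus ?thesis
    using assms by (intro zorder_zero_eqI[OF hol]) auto
qed

theorem theorem7p1:
  shows "(\<Sum>z\<in>{z \<in> ball 0 (1/2). D z = 0}. zorder D z) = 1 \<and>
    (\<exists>q0::real. {z \<in> ball 0 (1/2). D z = 0} = {complex_of_real q0} \<and>
       zorder D (complex_of_real q0) = 1 \<and>
       0 < q0 \<and> 29/100 < q0 \<and> q0 < 293/1000)"
proof -
  obtain q0 :: real where q0: "29/100 < q0" "q0 < 293/1000" "D (of_real q0) = 0"
    using ex_real_zero by blast
  have zeros: "{z \<in> ball 0 (1/2). D z = 0} = {complex_of_real q0}"
    using q0 D_eq_imp_eq[of _ "of_real q0"] by auto
  have "zorder D (complex_of_real q0) = 1"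
    using q0 by (intro zorder_D_eq_1) auto
  moreover have "0 < q0" using q0 by linarith
  ultimately show ?thesis
    using q0 unfolding zeros by (intro conjI exI[of _ q0]) simp_all
qed

end
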